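(* Let $n \in \mathbb{N}$ with $n \geq 2$. Then there exists $f(n) \in \mathbb{N}$ such that for all $m \in \mathbb{N}$ and all positive contractions $A, B \in \mathcal{M}_m$ with $A \prec_{\mathrm{tr}} B$, there exist unitaries $U_1, \ldots, U_{f(n)} \in \mathcal{M}_m$ and $t_1, \ldots, t_{f(n)} \in [0,1]$ such that $\sum_{k=1}^{f(n)} t_k = 1$ and \[ \left\| A - \sum_{k=1}^{f(n)} t_k U_k^* B U_k \right\| < \frac{4}{n-1} + \frac{5}{n}. \] In particular, one may take $f(n) = 2^{\frac{1}{6}(n^3 - n)}$.
   Context: $\mathcal{M}_m$ is the C$^*$-algebra of $m \times m$ complex matrices with the operator norm. For self-adjoint $A, B \in \mathcal{M}_m$ with eigenvalues (with multiplicity) $\alpha_1 \geq \cdots \geq \alpha_m$ and $\beta_1 \geq \cdots \geq \beta_m$, $A \prec_{\mathrm{tr}} B$ (majorization with respect to the normalized trace) means $\sum_{k=1}^l \alpha_k \leq \sum_{k=1}^l \beta_k$ for all $l \in \{1,\ldots,m\}$ and $\sum_{k=1}^m \alpha_k = \sum_{k=1}^m \beta_k$. *)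

theory Defs
  imports
    "HOL-Analysis.L2_Norm"
    "Jordan_Normal_Form.Spectral_Radius"
    "Jordan_Normal_Form.Schur_Decomposition"
begin

definition selfadjoint_mat :: "nat \<Rightarrow> complex mat \<Rightarrow> bool" where
  "selfadjoint_mat m A \<longleftrightarrow> A \<in> carrier_mat m m \<and> mat_adjoint A = A"

definition unitary_mat :: "nat \<Rightarrow> complex mat \<Rightarrow> bool" where
  "unitary_mat m U \<longleftrightarrow> U \<in> carrier_mat m m \<and>
     mat_adjoint U * U = 1\<^sub>m m \<and> U * mat_adjoint U = 1\<^sub>m m"

text \<open>Positivity in the C*-algebra sense: self-adjoint with spectrum in the nonnegative reals.\<close>

definition positive_mat :: "nat \<Rightarrow> complex mat \<Rightarrow> bool" where
  "positive_mat m A \<longleftrightarrow> selfadjoint_mat m A \<and> spectrum A \<subseteq> complex_of_real ` {0..}"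

definition vec_norm2 :: "complex vec \<Rightarrow> real" where
  "vec_norm2 v = L2_set (\<lambda>i. cmod (v $ i)) {..<dim_vec v}"

text \<open>The set under the supremum is bounded and contains 0 (take \<open>x = 0\<close>), so the supremum is
  meaningful, also for a matrix without rows or columns.\<close>

definition op_norm :: "complex mat \<Rightarrow> real" where
  "op_norm A = (SUP x \<in> {x \<in> carrier_vec (dim_col A). vec_norm2 x \<le> 1}. vec_norm2 (A *\<^sub>v x))"

definition positive_contraction :: "nat \<Rightarrow> complex mat \<Rightarrow> bool" where
  "positive_contraction m A \<longleftrightarrow> positive_mat m A \<and> op_norm A \<le> 1"

text \<open>The eigenvalues in decreasing order, repeated according to their multiplicity as roots of
  the characteristic polynomial. This is intended for self-adjoint matrices only: their
  eigenvalues are real, so that taking real parts loses nothing, and their algebraic and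
  geometric multiplicities agree.\<close>

definition eigenvalues_desc :: "complex mat \<Rightarrow> real list" where
  "eigenvalues_desc A = rev (sorted_list_of_multiset (image_mset Re (proots (char_poly A))))"

text \<open>List positions start at 0, so the \<open>k\<close>-th largest eigenvalue is at position \<open>k - 1\<close>.\<close>

definition tr_majorized :: "nat \<Rightarrow> complex mat \<Rightarrow> complex mat \<Rightarrow> bool" where
  "tr_majorized m A B \<longleftrightarrow>
     (\<forall>l\<in>{1..m}. (\<Sum>k=1..l. eigenvalues_desc A ! (k - 1)) \<le> (\<Sum>k=1..l. eigenvalues_desc B ! (k - 1))) \<and>
     (\<Sum>k=1..m. eigenvalues_desc A ! (k - 1)) = (\<Sum>k=1..m. eigenvalues_desc B ! (k - 1))"

definition unitary_combination ::
  "nat \<Rightarrow> nat \<Rightarrow> (nat \<Rightarrow> real) \<Rightarrow> (nat \<Rightarrow> complex mat) \<Rightarrow> complex mat \<Rightarrow> complex mat" where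
  "unitary_combination m N t U B =
     (\<Oplus>\<^bsub>module_mat TYPE(complex) m m\<^esub> k\<in>{1..N}.
        complex_of_real (t k) \<cdot>\<^sub>m (mat_adjoint (U k) * B * U k))"

text \<open>\<open>N\<close> unitaries are enough for the precision attached to \<open>n\<close>, uniformly in the matrix
  size \<open>m\<close> and in the matrices.\<close>

definition suffices_unitaries :: "nat \<Rightarrow> nat \<Rightarrow> bool" where
  "suffices_unitaries n N \<longleftrightarrow>
     (\<forall>m A B. positive_contraction m A \<longrightarrow> positive_contraction m B \<longrightarrow> tr_majorized m A B \<longrightarrow>
       (\<exists>(U :: nat \<Rightarrow> complex mat) (t :: nat \<Rightarrow> real).
          (\<forall>k\<in>{1..N}. unitary_mat m (U k)) \<and>
          (\<forall>k\<in>{1..N}. t k \<in> {0..1}) \<and>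
          (\<Sum>k=1..N. t k) = 1 \<and>
          op_norm (A - unitary_combination m N t U B) < 4 / (real n - 1) + 5 / real n))"

end

theory Submission
  imports Defs "HOL-Combinatorics.Permutations"
begin

text \<open>
  Diagonalise \<open>A\<close> and \<open>B\<close> with eigenvalues \<open>a\<close> and \<open>b\<close>. Reordering \<open>b\<close> by permutations
  \<open>\<sigma> 0, \<dots>, \<sigma> (N - 1)\<close> is conjugation by unitaries, so it suffices to make all errors
  \<open>e i = (\<Sum>s<N. b (\<sigma> s i)) / N - a i\<close> small with \<open>N\<close> independent of the size \<open>m\<close>. Choose the
  permutations to minimise \<open>\<Sum>i<m. (e i)\<^sup>2\<close>. As no transposition improves the minimum,
  \<open>e i > e j + 1 / N\<close> forces \<open>b (\<sigma> s i) \<le> b (\<sigma> s j)\<close> for every \<open>s\<close>. If some error were at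
  least \<open>2 / K\<close>, with \<open>N \<ge> K\<^sup>2\<close>, a pigeonhole argument over \<open>K\<close> levels of width \<open>1 / N\<close> would
  yield a level \<open>c > 1 / K\<close> such that the entries at positions with error below \<open>c\<close> dominate
  the others up to \<open>1 / K\<close> on average. By majorization these positions then have total error
  at least \<open>- 1 / K\<close> times the number of the other positions, contradicting that all errors
  sum to zero.
\<close>

section \<open>Averages of few permutations\<close>

text \<open>\<open>maj\<close> is weak majorization in truncated form: maximising over
  \<open>T\<close> turns the left side into the sum of all \<open>max (a i - t) 0\<close>.
  \<open>swap\<close> is local optimality of the arrangement \<open>v\<close>; its tolerance
  \<open>1 / N\<close> is the most that exchanging two values of one row can move an
  average.\<close>

lemma averaging_error_upper:
  fixes v :: "nat \<Rightarrow> nat \<Rightarrow> real" and a e :: "nat \<Rightarrow> real" and K N m :: nat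
  assumes K: "K > 0" and NK: "N \<ge> K\<^sup>2"
    and range: "\<And>s i. s < N \<Longrightarrow> i < m \<Longrightarrow> v s i \<in> {0..1}"
    and e: "\<And>i. i < m \<Longrightarrow> e i = (\<Sum>s<N. v s i) / N - a i"
    and swap: "\<And>s i j. s < N \<Longrightarrow> i < m \<Longrightarrow> j < m \<Longrightarrow> e i > e j + 1 / N \<Longrightarrow> v s i \<le> v s j"
    and sum0: "(\<Sum>i<m. e i) = 0"
    and maj: "\<And>s T t. s < N \<Longrightarrow> T \<subseteq> {..<m} \<Longrightarrow> (\<Sum>i\<in>T. a i - t) \<le> (\<Sum>i<m. max (v s i - t) 0)"
    and p: "p < m"
  shows "e p < 2 / K"
proof (rule ccontr)
  assume "\<not> e p < 2 / K"
  hence ep: "e p \<ge> 2 / K" by simp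
  have N: "N > 0" using K NK by (cases N) auto
  \<comment> \<open>The levels descend from \<open>2 / K\<close> in steps of \<open>1 / N\<close>,
    the tolerance in \<open>swap\<close>. Fewer than \<open>K\<close> steps keep them above
    \<open>1 / K\<close>, since \<open>N\<close> is at least the square of \<open>K\<close>.\<close>
  define c where "c j = 2 / K - real j / N" for j :: nat
  \<comment> \<open>The inserted 1 is a default that keeps the set nonempty when no error lies below
    the level. As it bounds all values of \<open>v s\<close>, it does not change the minimum
    otherwise.\<close>
  define G where "G s j = insert 1 (v s ` {i. i < m \<and> e i < c j})" for s j
  define h where "h s j = Min (G s j)" for s j
  define H where "H j = (\<Sum>s<N. h s j) / N" for j
  have fin: "finite (G s j)" and ne: "G s j \<noteq> {}" for s j unfolding G_def by auto
  have h01: "h s j \<in> {0..1}" if "s < N" for s j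
  proof -
    have "h s j \<in> G s j" unfolding h_def by (rule Min_in[OF fin ne])
    thus ?thesis using range that unfolding G_def by auto
  qed
  have H01: "H j \<in> {0..1}" for j
  proof -
    have "(\<Sum>s<N. h s j) \<le> (\<Sum>s<N. 1)" by (rule sum_mono) (use h01 in auto)
    moreover have "(\<Sum>s<N. h s j) \<ge> 0" by (rule sum_nonneg) (use h01 in auto)
    ultimately show ?thesis using N unfolding H_def by (auto simp: field_simps)
  qed
  \<comment> \<open>Pigeonhole: the \<open>K\<close> increments telescope to
    \<open>H K - H 0\<close>, which is at most 1 because \<open>H\<close> stays in the unit
    interval.\<close>
  have "\<exists>j<K. H (Suc j) - H j \<le> 1 / K"
  proof (rule ccontr)
    assume "\<not> ?thesis"
    hence *: "H (Suc j) - H j > 1 / K" if "j < K" for j using that by force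
    have "(\<Sum>j<K. 1 / real K) < (\<Sum>j<K. H (Suc j) - H j)"
      by (rule sum_strict_mono) (use K * in auto)
    also have "\<dots> = H K - H 0" by (rule sum_lessThan_telescope)
    finally show False using H01[of K] H01[of 0] K by simp
  qed
  then obtain j where j: "j < K" and Hj: "H (Suc j) - H j \<le> 1 / K" by blast
  define S where "S = {i. i < m \<and> e i \<ge> c j}"
  define T where "T = {i. i < m \<and> e i < c j}"
  have ST: "{..<m} = T \<union> S" "T \<inter> S = {}" "finite S" "finite T" unfolding S_def T_def by auto
  have cj: "c j > 1 / K"
  proof -
    have "real j / N \<le> real j / (real K)\<^sup>2"
      using NK K N by (intro divide_left_mono) (auto simp flip: of_nat_power)
    also have "\<dots> < real K / (real K)\<^sup>2" using j by (intro divide_strict_right_mono) auto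
    also have "\<dots> = 1 / K" using K by (simp add: power2_eq_square)
    finally show ?thesis unfolding c_def by (simp add: field_simps)
  qed
  have "c j \<le> 2 / K" unfolding c_def by simp
  hence "p \<in> S" using p ep unfolding S_def by auto
  hence Spos: "card S > 0" using ST by (auto simp: card_gt_0_iff)
  have low: "h s j \<le> v s i" if "i \<in> T" for s i
    unfolding h_def by (rule Min_le[OF fin]) (use that in \<open>auto simp: T_def G_def\<close>)
  \<comment> \<open>An error at level \<open>c j\<close> or higher exceeds one below
    \<open>c (Suc j)\<close> by more than \<open>1 / N\<close>, so \<open>swap\<close> orders the
    two values. Thus \<open>v s i\<close> is below every element whose minimum is
    \<open>h s (Suc j)\<close>.\<close>
  have up: "v s i \<le> h s (Suc j)" if s: "s < N" and i: "i \<in> S" for s i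
  proof -
    have "v s i \<le> g" if g: "g \<in> G s (Suc j)" for g
    proof (cases "g = 1")
      case True thus ?thesis using range[OF s, of i] i unfolding S_def by auto
    next
      case False
      then obtain k where k: "g = v s k" "k < m" "e k < c (Suc j)"
        using g unfolding G_def by auto
      have "e i > e k + 1 / N" using k i unfolding c_def S_def by (auto simp: add_divide_distrib)
      thus ?thesis using swap[OF s, of i k] i k unfolding S_def by auto
    qed
    thus ?thesis unfolding h_def by (subst Min_ge_iff[OF fin ne]) blast
  qed
  \<comment> \<open>Truncate at \<open>t = h s j\<close>: on \<open>T\<close> all values are at
    least \<open>t\<close>, so nothing is cut off, and each position of \<open>S\<close> contributes
    at most the gap \<open>h s (Suc j) - h s j\<close>.\<close>
  have main: "(\<Sum>i\<in>T. a i) \<le> (\<Sum>i\<in>T. v s i) + card S * (h s (Suc j) - h s j)"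
    if s: "s < N" for s
  proof -
    have jj: "h s j \<le> h s (Suc j)"
    proof -
      have "c (Suc j) \<le> c j" unfolding c_def by (simp add: divide_right_mono)
      hence "G s (Suc j) \<subseteq> G s j" unfolding G_def by (auto intro: order_less_le_trans)
      thus ?thesis unfolding h_def using fin ne by (intro Min_antimono) auto
    qed
    have "(\<Sum>i\<in>T. a i - h s j) \<le> (\<Sum>i<m. max (v s i - h s j) 0)"
      by (rule maj[OF s]) (auto simp: T_def)
    also have "\<dots> = (\<Sum>i\<in>T. max (v s i - h s j) 0) + (\<Sum>i\<in>S. max (v s i - h s j) 0)"
      unfolding ST(1) by (rule sum.union_disjoint) (use ST in auto)
    also have "(\<Sum>i\<in>T. max (v s i - h s j) 0) = (\<Sum>i\<in>T. v s i - h s j)"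
      by (rule sum.cong) (use low in auto)
    also have "(\<Sum>i\<in>S. max (v s i - h s j) 0) \<le> (\<Sum>i\<in>S. h s (Suc j) - h s j)"
      by (rule sum_mono) (use up[OF s] jj in auto)
    finally show ?thesis by (simp add: sum_subtractf)
  qed
  \<comment> \<open>Averaging over \<open>s\<close> shows that the total error on \<open>T\<close>
    is at least \<open>- card S / K\<close>. Every error on the nonempty set \<open>S\<close> is at
    least \<open>c j > 1 / K\<close>, so the total over all positions would be positive.\<close>
  have "real N * (\<Sum>i\<in>T. a i) = (\<Sum>s<N. \<Sum>i\<in>T. a i)" by simp
  also have "\<dots> \<le> (\<Sum>s<N. (\<Sum>i\<in>T. v s i) + card S * (h s (Suc j) - h s j))"
    by (rule sum_mono) (use main in auto)
  also have "\<dots> = (\<Sum>i\<in>T. \<Sum>s<N. v s i) + card S * (\<Sum>s<N. h s (Suc j) - h s j)"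
    by (subst sum.swap) (simp add: sum.distrib sum_distrib_left)
  also have "(\<Sum>i\<in>T. \<Sum>s<N. v s i) = real N * (\<Sum>i\<in>T. e i + a i)"
    unfolding sum_distrib_left by (rule sum.cong) (use e N in \<open>auto simp: T_def\<close>)
  also have "(\<Sum>s<N. h s (Suc j) - h s j) = real N * (H (Suc j) - H j)"
    using N by (simp add: H_def sum_subtractf field_simps)
  finally have "real N * 0 \<le> real N * ((\<Sum>i\<in>T. e i) + card S * (H (Suc j) - H j))"
    by (simp add: sum.distrib algebra_simps)
  hence "0 \<le> (\<Sum>i\<in>T. e i) + card S * (H (Suc j) - H j)"
    using N by (simp only: mult_le_cancel_left_pos of_nat_0_less_iff)
  also have "\<dots> \<le> (\<Sum>i\<in>T. e i) + card S * (1 / K)"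
    using Hj by (intro add_left_mono mult_left_mono) auto
  also have "\<dots> < (\<Sum>i\<in>T. e i) + card S * c j"
    using cj Spos by (intro add_strict_left_mono mult_strict_left_mono) auto
  also have "\<dots> = (\<Sum>i\<in>T. e i) + (\<Sum>i\<in>S. c j)" by simp
  also have "\<dots> \<le> (\<Sum>i\<in>T. e i) + (\<Sum>i\<in>S. e i)"
    by (intro add_left_mono sum_mono) (auto simp: S_def)
  also have "\<dots> = (\<Sum>i<m. e i)" unfolding ST(1) by (rule sum.union_disjoint[symmetric]) (use ST in auto)
  finally show False using sum0 by simp
qed

text \<open>The lower bound is the upper bound for the reflected data \<open>1 - v\<close> and
  \<open>1 - a\<close>, whose errors are \<open>- e\<close>. Reflection preserves the majorization
  hypothesis because the totals of \<open>a\<close> and \<open>v s\<close> agree.\<close>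

lemma averaging_error_abs:
  fixes v :: "nat \<Rightarrow> nat \<Rightarrow> real" and a e :: "nat \<Rightarrow> real" and K N m :: nat
  assumes K: "K > 0" and NK: "N \<ge> K\<^sup>2"
    and range: "\<And>s i. s < N \<Longrightarrow> i < m \<Longrightarrow> v s i \<in> {0..1}"
    and e: "\<And>i. i < m \<Longrightarrow> e i = (\<Sum>s<N. v s i) / N - a i"
    and swap: "\<And>s i j. s < N \<Longrightarrow> i < m \<Longrightarrow> j < m \<Longrightarrow> e i > e j + 1 / N \<Longrightarrow> v s i \<le> v s j"
    and sums: "\<And>s. s < N \<Longrightarrow> (\<Sum>i<m. v s i) = (\<Sum>i<m. a i)"
    and maj: "\<And>s T t. s < N \<Longrightarrow> T \<subseteq> {..<m} \<Longrightarrow> (\<Sum>i\<in>T. a i - t) \<le> (\<Sum>i<m. max (v s i - t) 0)"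
    and p: "p < m"
  shows "\<bar>e p\<bar> < 2 / K"
proof -
  have N: "N > 0" using K NK by (cases N) auto
  have "(\<Sum>i<m. \<Sum>s<N. v s i) = (\<Sum>s<N. \<Sum>i<m. v s i)" by (rule sum.swap)
  also have "\<dots> = real N * (\<Sum>i<m. a i)" using sums by simp
  finally have sum0: "(\<Sum>i<m. e i) = 0"
    using N by (simp add: e sum_subtractf flip: sum_divide_distrib)
  have "e p < 2 / K"
    by (rule averaging_error_upper[where v = v and a = a and N = N and m = m])
      (assumption | rule K NK range e swap sum0 maj p)+
  moreover have "- e p < 2 / K"
  proof (rule averaging_error_upper[where v = "\<lambda>s i. 1 - v s i" and a = "\<lambda>i. 1 - a i" and N = N and m = m
        and e = "\<lambda>i. - e i"])
    show "(\<Sum>i\<in>T. (1 - a i) - t) \<le> (\<Sum>i<m. max ((1 - v s i) - t) 0)"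
      if s: "s < N" and T: "T \<subseteq> {..<m}" for s T t
    proof -
      \<comment> \<open>Pass to the complement of \<open>T\<close>, where \<open>maj\<close> applies
        at the level \<open>1 - t\<close>. Equal totals and \<open>max x 0 - x = max (- x) 0\<close>
        then give the reflected truncation.\<close>
      have "(\<Sum>i\<in>T. (1 - a i) - t) = (\<Sum>i\<in>{..<m} - T. a i - (1 - t)) - (\<Sum>i<m. a i - (1 - t))"
      proof -
        have "(\<Sum>i\<in>T. (1 - a i) - t) = - (\<Sum>i\<in>T. a i - (1 - t))"
          unfolding sum_negf[symmetric] by (rule sum.cong) auto
        thus ?thesis using sum.subset_diff[OF T, of "\<lambda>i. a i - (1 - t)"] by simp
      qed
      also have "(\<Sum>i\<in>{..<m} - T. a i - (1 - t)) \<le> (\<Sum>i<m. max (v s i - (1 - t)) 0)"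
        by (rule maj[OF s]) auto
      also have "(\<Sum>i<m. a i - (1 - t)) = (\<Sum>i<m. v s i - (1 - t))"
        using sums[OF s] by (simp add: sum_subtractf)
      also have "(\<Sum>i<m. max (v s i - (1 - t)) 0) - (\<Sum>i<m. v s i - (1 - t)) =
          (\<Sum>i<m. max ((1 - v s i) - t) 0)"
        unfolding sum_subtractf[symmetric] by (rule sum.cong) auto
      finally show ?thesis by simp
    qed
    show "(\<Sum>i<m. - e i) = 0" using sum0 by (simp add: sum_negf)
    show "- e i = (\<Sum>s<N. 1 - v s i) / N - (1 - a i)" if "i < m" for i
      using e[OF that] N by (simp add: sum_subtractf field_simps)
    show "1 - v s i \<le> 1 - v s j" if "s < N" "i < m" "j < m" "- e i > - e j + 1 / N" for s i j
      using swap[of s j i] that by simp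
    show "1 - v s i \<in> {0..1}" if "s < N" "i < m" for s i using range[OF that] by auto
  qed (use K NK p in auto)
  ultimately show ?thesis by auto
qed

lemma sum_permutes_compose:
  assumes "p permutes {..<m}"
  shows "(\<Sum>i<m. f (p i)) = (\<Sum>i<m. f i)"
  using sum.permute[OF assms, of f] by (simp add: o_def)

text \<open>The number \<open>N\<close> of permutations depends on the precision \<open>K\<close>
  only, not on \<open>m\<close>. A family minimising the total squared error cannot be improved by a
  single exchange, which provides the hypothesis \<open>swap\<close> above.\<close>

lemma exists_permutation_average:
  fixes a b :: "nat \<Rightarrow> real" and K N m :: nat
  assumes K: "K > 0" and NK: "N \<ge> K\<^sup>2"
    and range: "\<And>i. i < m \<Longrightarrow> b i \<in> {0..1}"
    and sums: "(\<Sum>i<m. b i) = (\<Sum>i<m. a i)"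
    and maj: "\<And>T t. T \<subseteq> {..<m} \<Longrightarrow> (\<Sum>i\<in>T. a i - t) \<le> (\<Sum>i<m. max (b i - t) 0)"
  obtains \<sigma> where "\<And>s. s < N \<Longrightarrow> \<sigma> s permutes {..<m}"
    and "\<And>i. i < m \<Longrightarrow> \<bar>(\<Sum>s<N. b (\<sigma> s i)) / N - a i\<bar> < 2 / K"
proof -
  have N: "N > 0" using K NK by (cases N) auto
  \<comment> \<open>\<open>PiE\<close> fixes the families outside \<open>{..<N}\<close>, so there
    are only finitely many and a minimiser exists.\<close>
  define X where "X = PiE {..<N} (\<lambda>_. {p. p permutes {..<m}})"
  define err where "err \<sigma> i = (\<Sum>s<N. b (\<sigma> s i)) / N - a i" for \<sigma> :: "nat \<Rightarrow> nat \<Rightarrow> nat" and i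
  define \<Phi> where "\<Phi> \<sigma> = (\<Sum>i<m. (err \<sigma> i)\<^sup>2)" for \<sigma>
  have "finite X" unfolding X_def by (intro finite_PiE finite_permutations) auto
  moreover have "(\<lambda>s\<in>{..<N}. id) \<in> X" unfolding X_def by (auto simp: permutes_id)
  ultimately obtain \<sigma> where \<sigma>: "\<sigma> \<in> X" and min: "\<And>\<tau>. \<tau> \<in> X \<Longrightarrow> \<Phi> \<sigma> \<le> \<Phi> \<tau>"
    using ex_is_arg_min_if_finite[of X \<Phi>] unfolding is_arg_min_linorder by blast
  have perm: "\<sigma> s permutes {..<m}" if "s < N" for s using \<sigma> that unfolding X_def by auto
  have in_m: "\<sigma> s i < m" if "s < N" "i < m" for s i
    using permutes_in_image[OF perm[OF that(1)], of i] that(2) by simp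
  have swap: "b (\<sigma> s i) \<le> b (\<sigma> s j)"
    if s: "s < N" and i: "i < m" and j: "j < m" and gap: "err \<sigma> i > err \<sigma> j + 1 / N" for s i j
  proof (rule ccontr)
    assume not: "\<not> b (\<sigma> s i) \<le> b (\<sigma> s j)"
    \<comment> \<open>Exchanging the entries \<open>i\<close> and \<open>j\<close> of
      \<open>\<sigma> s\<close> lowers the error at \<open>i\<close> by \<open>d\<close> and raises
      the error at \<open>j\<close> by \<open>d\<close>. As \<open>b\<close> has values in the unit
      interval, \<open>d\<close> is at most \<open>1 / N\<close>.\<close>
    define d where "d = (b (\<sigma> s i) - b (\<sigma> s j)) / N"
    define \<tau> where "\<tau> = \<sigma>(s := \<sigma> s \<circ> Transposition.transpose i j)"
    have d0: "d > 0" using not N unfolding d_def by simp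
    have d1: "d \<le> 1 / N" unfolding d_def
      using range[OF in_m[OF s i]] range[OF in_m[OF s j]] by (intro divide_right_mono) auto
    have ij: "i \<noteq> j" using not by auto
    have "\<tau> \<in> X"
      using \<sigma> s i j unfolding X_def \<tau>_def
      by (auto simp: PiE_def Pi_def extensional_def intro!: permutes_compose permutes_swap_id)
    have err': "err \<tau> k = err \<sigma> k + (b (\<sigma> s (Transposition.transpose i j k)) - b (\<sigma> s k)) / N" for k
    proof -
      have "(\<Sum>r<N. b (\<tau> r k)) = b (\<sigma> s (Transposition.transpose i j k)) + (\<Sum>r\<in>{..<N}-{s}. b (\<sigma> r k))"
        by (subst sum.remove[of _ s]) (auto simp: s \<tau>_def)
      moreover have "(\<Sum>r<N. b (\<sigma> r k)) = b (\<sigma> s k) + (\<Sum>r\<in>{..<N}-{s}. b (\<sigma> r k))"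
        by (subst sum.remove[of _ s]) (auto simp: s)
      ultimately show ?thesis by (simp add: err_def add_divide_distrib diff_divide_distrib)
    qed
    have split: "(\<Sum>k<m. f k) = f i + f j + (\<Sum>k\<in>{..<m}-{i,j}. f k)" for f :: "nat \<Rightarrow> real"
    proof -
      have "{..<m} - {i} - {j} = {..<m} - {i,j}" by auto
      thus ?thesis using i j ij by (simp add: sum.remove[of "{..<m}" i] sum.remove[of "{..<m} - {i}" j])
    qed
    have ei: "err \<tau> i = err \<sigma> i - d" and ej: "err \<tau> j = err \<sigma> j + d"
      unfolding err' d_def by (auto simp: diff_divide_distrib)
    have "(\<Sum>k\<in>{..<m}-{i,j}. (err \<tau> k)\<^sup>2) = (\<Sum>k\<in>{..<m}-{i,j}. (err \<sigma> k)\<^sup>2)"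
      by (rule sum.cong) (auto simp: err' Transposition.transpose_def)
    \<comment> \<open>Only two squares change. With
      \<open>g = err \<sigma> i - err \<sigma> j\<close> the difference is
      \<open>2 * d * (d - g)\<close>, negative because \<open>g > 1 / N \<ge> d\<close>.\<close>
    hence "\<Phi> \<tau> - \<Phi> \<sigma> = 2 * d * (err \<sigma> j + d - err \<sigma> i)"
      unfolding \<Phi>_def split[of "\<lambda>k. (err \<tau> k)\<^sup>2"] split[of "\<lambda>k. (err \<sigma> k)\<^sup>2"] ei ej
      by (simp add: power2_eq_square algebra_simps)
    also have "\<dots> < 0" using d0 d1 gap by (intro mult_pos_neg) auto
    finally show False using min[OF \<open>\<tau> \<in> X\<close>] by simp
  qed
  have "\<bar>err \<sigma> p\<bar> < 2 / K" if p: "p < m" for p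
  proof (rule averaging_error_abs[where v = "\<lambda>s i. b (\<sigma> s i)" and a = a and N = N and m = m])
    show "(\<Sum>i<m. b (\<sigma> s i)) = (\<Sum>i<m. a i)" if "s < N" for s
      using sum_permutes_compose[OF perm[OF that], of b] sums by simp
    show "(\<Sum>i\<in>T. a i - t) \<le> (\<Sum>i<m. max (b (\<sigma> s i) - t) 0)" if "s < N" "T \<subseteq> {..<m}" for s T t
      using sum_permutes_compose[OF perm[OF that(1)], of "\<lambda>i. max (b i - t) 0"] maj[OF that(2)] by simp
    show "b (\<sigma> s i) \<in> {0..1}" if "s < N" "i < m" for s i using range in_m that by blast
    show "err \<sigma> i = (\<Sum>s<N. b (\<sigma> s i)) / N - a i" for i by (rule err_def)
  qed (assumption | rule K NK p swap)+
  thus ?thesis using that perm unfolding err_def by blast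
qed

text \<open>The left side is largest when \<open>T\<close> consists of the positions with
  \<open>a i > t\<close>. Since \<open>a\<close> is decreasing these form a prefix, where
  \<open>pre\<close> applies.\<close>

lemma sum_le_sum_max_of_prefix_sums:
  fixes a b :: "nat \<Rightarrow> real"
  assumes dec: "\<And>i j. i \<le> j \<Longrightarrow> j < m \<Longrightarrow> a j \<le> a i"
    and pre: "\<And>l. l \<le> m \<Longrightarrow> (\<Sum>i<l. a i) \<le> (\<Sum>i<l. b i)"
    and T: "T \<subseteq> {..<m}"
  shows "(\<Sum>i\<in>T. a i - t) \<le> (\<Sum>i<m. max (b i - t) 0)"
proof -
  define L where "L = {i. i < m \<and> a i > t}"
  have "\<exists>l\<le>m. L = {..<l}"
  proof (cases "L = {}")
    case False
    have fin: "finite L" unfolding L_def by auto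
    have M: "Max L \<in> L" using fin False by (rule Max_in)
    have "L = {..<Suc (Max L)}"
    proof safe
      fix i assume "i \<in> L" thus "i < Suc (Max L)" using fin by (simp add: less_Suc_eq_le)
    next
      fix i assume "i < Suc (Max L)"
      thus "i \<in> L" using M dec[of i "Max L"] unfolding L_def by auto
    qed
    moreover have "Suc (Max L) \<le> m" using M unfolding L_def by simp
    ultimately show ?thesis by blast
  qed auto
  then obtain l where l: "l \<le> m" "L = {..<l}" by blast
  have "(\<Sum>i\<in>T. a i - t) \<le> (\<Sum>i\<in>T. max (a i - t) 0)" by (rule sum_mono) auto
  also have "\<dots> \<le> (\<Sum>i<m. max (a i - t) 0)" by (rule sum_mono2) (use T in auto)
  also have "\<dots> = (\<Sum>i\<in>L. max (a i - t) 0)"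
    by (rule sum.mono_neutral_right) (auto simp: L_def)
  also have "\<dots> = (\<Sum>i\<in>L. a i - t)" by (rule sum.cong) (auto simp: L_def)
  also have "\<dots> \<le> (\<Sum>i<l. b i - t)" using pre[OF l(1)] unfolding l(2) by (simp add: sum_subtractf)
  also have "\<dots> \<le> (\<Sum>i<l. max (b i - t) 0)" by (rule sum_mono) auto
  also have "\<dots> \<le> (\<Sum>i<m. max (b i - t) 0)" by (rule sum_mono2) (use l in auto)
  finally show ?thesis .
qed

text \<open>This supplies \<open>N \<ge> K\<^sup>2\<close> for \<open>K = n - 1\<close>. The
  division is exact, since \<open>n ^ 3 - n\<close> is the product of \<open>n - 1\<close>,
  \<open>n\<close> and \<open>n + 1\<close>.\<close>

lemma square_le_two_power:
  fixes n :: nat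
  assumes "n \<ge> 2"
  shows "(n - 1)\<^sup>2 \<le> 2 ^ ((n ^ 3 - n) div 6)"
proof -
  obtain k where n: "n = k + 2" using assms by (metis add.commute le_Suc_ex)
  \<comment> \<open>With \<open>n = k + 2\<close> the exponent is at least \<open>2 * k\<close>,
    while \<open>n - 1 = k + 1\<close> is at most \<open>2 ^ k\<close>; squaring the latter
    suffices.\<close>
  have "2 * k * 6 + n \<le> n ^ 3" unfolding n by (cases k) (auto simp: power3_eq_cube algebra_simps)
  hence k: "2 * k \<le> (n ^ 3 - n) div 6" by (simp add: less_eq_div_iff_mult_less_eq)
  have "n - 1 \<le> 2 ^ k" unfolding n by (simp add: less_exp Suc_leI)
  hence "(n - 1)\<^sup>2 \<le> (2 ^ k)\<^sup>2" by (rule power_mono) simp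
  also have "\<dots> = 2 ^ (2 * k)" by (simp add: power_mult[symmetric] mult.commute)
  also have "\<dots> \<le> 2 ^ ((n ^ 3 - n) div 6)" using k by (rule power_increasing) simp
  finally show ?thesis .
qed

section \<open>Unitary diagonalization\<close>

lemma dim_mat_adjoint [simp]:
  "dim_row (mat_adjoint A) = dim_col A" "dim_col (mat_adjoint A) = dim_row A"
  by (auto simp: mat_adjoint_def)

lemma mat_adjoint_carrier [simp, intro]:
  "A \<in> carrier_mat n m \<Longrightarrow> mat_adjoint A \<in> carrier_mat m n"
  by (intro carrier_matI) auto

lemma index_mat_adjoint [simp]:
  "i < dim_col A \<Longrightarrow> j < dim_row A \<Longrightarrow> mat_adjoint A $$ (i, j) = conjugate (A $$ (j, i))"
  unfolding mat_adjoint_def by (simp add: mat_of_rows_index)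

lemma mat_adjoint_adjoint [simp]: "mat_adjoint (mat_adjoint A) = A"
  by (rule eq_matI) auto

lemma mat_adjoint_mult:
  fixes A B :: "'a :: conjugatable_field mat"
  assumes "A \<in> carrier_mat n k" "B \<in> carrier_mat k m"
  shows "mat_adjoint (A * B) = mat_adjoint B * mat_adjoint A"
proof (rule eq_matI)
  fix i j assume *: "i < dim_row (mat_adjoint B * mat_adjoint A)" "j < dim_col (mat_adjoint B * mat_adjoint A)"
  have "conjugate (\<Sum>l = 0..<k. A $$ (j, l) * B $$ (l, i)) = (\<Sum>l = 0..<k. conjugate (B $$ (l, i)) * conjugate (A $$ (j, l)))"
    by (simp add: sum_conjugate conjugate_dist_mul mult.commute)
  thus "mat_adjoint (A * B) $$ (i, j) = (mat_adjoint B * mat_adjoint A) $$ (i, j)"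
    using * assms by (auto simp: scalar_prod_def)
qed (use assms in auto)

lemma unitary_mat_carrier:
  "unitary_mat n U \<Longrightarrow> U \<in> carrier_mat n n"
  by (simp add: unitary_mat_def)

lemma unitary_matI:
  assumes "U \<in> carrier_mat n n" "mat_adjoint U * U = 1\<^sub>m n"
  shows "unitary_mat n U"
  using assms mat_mult_left_right_inverse[of "mat_adjoint U" n U] by (auto simp: unitary_mat_def)

lemma unitary_mat_adjoint: "unitary_mat n U \<Longrightarrow> unitary_mat n (mat_adjoint U)"
  by (auto simp: unitary_mat_def)

lemma unitary_mat_mult:
  assumes U: "unitary_mat n U" and V: "unitary_mat n V"
  shows "unitary_mat n (U * V)"
proof (rule unitary_matI)
  have c: "U \<in> carrier_mat n n" "V \<in> carrier_mat n n" using U V by (simp_all add: unitary_mat_carrier)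
  have "mat_adjoint (U * V) * (U * V) = mat_adjoint V * (mat_adjoint U * U) * V"
    using c by (simp add: mat_adjoint_mult[of _ n n _ n] assoc_mult_mat[of _ n n _ n _ n] mult_carrier_mat[of _ n n _ n])
  thus "mat_adjoint (U * V) * (U * V) = 1\<^sub>m n"
    using U V c by (simp add: unitary_mat_def)
qed (intro mult_carrier_mat[of _ n n] unitary_mat_carrier U V)

lemma cscalar_prod_self: "v \<bullet>c v = complex_of_real ((vec_norm2 v)\<^sup>2)"
proof -
  have "(vec_norm2 v)\<^sup>2 = (\<Sum>i<dim_vec v. (cmod (v $ i))\<^sup>2)"
    unfolding vec_norm2_def L2_set_def by (intro real_sqrt_pow2 sum_nonneg) auto
  thus ?thesis
    by (simp add: scalar_prod_def lessThan_atLeast0 complex_norm_square[symmetric] del: of_real_power)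
qed

text \<open>Complete \<open>v\<close> to a basis and orthogonalise it: Gram-Schmidt leaves the first
  vector alone, so after normalisation the first column is a multiple of \<open>v\<close>.\<close>

lemma exists_unitary_mat_first_column:
  fixes v :: "complex vec"
  assumes v: "v \<in> carrier_vec n" and v0: "v \<noteq> 0\<^sub>v n"
  shows "\<exists>W c. unitary_mat n W \<and> col W 0 = c \<cdot>\<^sub>v v"
proof -
  interpret cof_vec_space n "TYPE(complex)" .
  define b where "b = basis_completion v"
  define ws where "ws = gram_schmidt n b"
  from basis_completion[OF v v0, folded b_def]
  have dist_b: "distinct b" and indep: "\<not> lin_dep (set b)" and b: "set b \<subseteq> carrier_vec n"
    and hdb: "hd b = v" and len_b: "length b = n" by auto
  have n: "n > 0" using v v0 by (cases n) auto
  from hdb len_b n obtain vs where bv: "b = v # vs" by (cases b) auto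
  from gram_schmidt_result[OF b dist_b indep refl, folded ws_def]
  have ws: "set ws \<subseteq> carrier_vec n" "corthogonal ws" "length ws = n" by (auto simp: len_b)
  have hdws: "ws ! 0 = v"
    using gram_schmidt_hd[OF v, of vs, folded bv, folded ws_def] ws(3) n by (cases ws) auto
  have wsc: "ws ! i \<in> carrier_vec n" if "i < n" for i using ws that by auto
  \<comment> \<open>\<open>gram_schmidt\<close> returns orthogonal nonzero vectors that are not
    normalised; \<open>r i\<close> is the missing factor.\<close>
  define r where "r i = complex_of_real (inverse (vec_norm2 (ws ! i)))" for i
  define W where "W = mat_of_cols n (map (\<lambda>i. r i \<cdot>\<^sub>v ws ! i) [0..<n])"
  have W: "W \<in> carrier_mat n n" unfolding W_def by auto
  have colW: "col W i = r i \<cdot>\<^sub>v ws ! i" if "i < n" for i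
    using that wsc unfolding W_def by (subst col_mat_of_cols) auto
  have "mat_adjoint W * W = 1\<^sub>m n"
  proof (rule eq_matI)
    fix i j assume "i < dim_row (1\<^sub>m n :: complex mat)" "j < dim_col (1\<^sub>m n :: complex mat)"
    hence i: "i < n" and j: "j < n" by auto
    have "row (mat_adjoint W) i = conjugate (col W i)"
      using i W by (intro eq_vecI) auto
    hence "(mat_adjoint W * W) $$ (i, j) = conjugate (col W i) \<bullet> col W j"
      using i j W by simp
    also have "\<dots> = cnj (r i) * r j * (ws ! j \<bullet>c ws ! i)"
      using i j wsc[OF i] wsc[OF j] unfolding colW[OF i] colW[OF j]
      by (simp add: scalar_prod_def sum_distrib_left conjugate_dist_mul mult_ac)
    also have "\<dots> = (if i = j then 1 else 0)"
    proof (cases "i = j")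
      case True
      have "ws ! i \<bullet>c ws ! i \<noteq> 0" using corthogonalD[OF ws(2), of i i] i ws(3) by auto
      thus ?thesis using True by (simp add: cscalar_prod_self r_def power2_eq_square field_simps)
    next
      case False
      thus ?thesis using corthogonalD[OF ws(2), of j i] i j ws(3) by auto
    qed
    finally show "(mat_adjoint W * W) $$ (i, j) = 1\<^sub>m n $$ (i, j)" using i j by simp
  qed (use W in auto)
  thus ?thesis using W colW[OF n] hdws by (metis unitary_matI)
qed

text \<open>In the induction below this lets a unitary found for the lower right block act on the
  whole space, fixing the first basis vector.\<close>

lemma four_block_mat_one_unitary:
  assumes V: "unitary_mat k V"
  shows "unitary_mat (Suc k) (four_block_mat (1\<^sub>m 1) (0\<^sub>m 1 k) (0\<^sub>m k 1) V)" (is "unitary_mat _ ?X")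
    and "mat_adjoint (four_block_mat (1\<^sub>m 1) (0\<^sub>m 1 k) (0\<^sub>m k 1) V) =
      four_block_mat (1\<^sub>m 1) (0\<^sub>m 1 k) (0\<^sub>m k 1) (mat_adjoint V)" (is "_ = ?Y")
proof -
  have c: "V \<in> carrier_mat k k" using V by (rule unitary_mat_carrier)
  show adj: "mat_adjoint ?X = ?Y"
    by (rule eq_matI) (use c in auto)
  have "mat_adjoint ?X * ?X = four_block_mat (1\<^sub>m 1) (0\<^sub>m 1 k) (0\<^sub>m k 1) (1\<^sub>m k)"
    unfolding adj using V c
    by (subst mult_four_block_mat[of _ 1 1 _ k _ k _ _ 1 _ k]) (auto simp: unitary_mat_def)
  also have "\<dots> = 1\<^sub>m (Suc k)" by (rule eq_matI) auto
  finally show "unitary_mat (Suc k) ?X" using c by (intro unitary_matI) auto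
qed

text \<open>Spectral theorem by splitting off one eigenvector at a time. The list \<open>es\<close>
  prescribes the order on the diagonal and may be any ordering of the roots; this freedom later
  realises permutations of eigenvalues by unitaries.\<close>

lemma selfadjoint_unitary_diagonalization:
  assumes "selfadjoint_mat n A" and "char_poly A = (\<Prod>a\<leftarrow>es. [:- a, 1:])"
  shows "\<exists>V. unitary_mat n V \<and> A = V * mat_diag n (\<lambda>i. es ! i) * mat_adjoint V"
  using assms
proof (induction es arbitrary: n A)
  case Nil
  hence A: "A \<in> carrier_mat n n" by (simp add: selfadjoint_mat_def)
  have "n = 0" using degree_monic_char_poly[OF A] Nil by simp
  hence "unitary_mat n (1\<^sub>m n) \<and> A = 1\<^sub>m n * mat_diag n (\<lambda>i. [] ! i) * mat_adjoint (1\<^sub>m n)"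
    using A by (auto simp: unitary_mat_def intro!: eq_matI)
  thus ?case by blast
next
  case (Cons e es n A)
  hence A: "A \<in> carrier_mat n n" and adjA: "mat_adjoint A = A" by (auto simp: selfadjoint_mat_def)
  \<comment> \<open>Comparing degrees shows that \<open>n\<close> is positive, so that a first row
    and column can be split off.\<close>
  have "degree (char_poly A) = Suc (degree (\<Prod>a\<leftarrow>es. [:- a, 1:]))"
    unfolding Cons.prems(2) list.map prod_list.Cons by (subst degree_mult_eq) (auto simp: prod_list_zero_iff)
  hence "n = Suc (degree (\<Prod>a\<leftarrow>es. [:- a, 1:]))" using degree_monic_char_poly[OF A] by simp
  then obtain k where n: "n = Suc k" by blast
  have "eigenvalue A e" unfolding eigenvalue_root_char_poly[OF A] Cons.prems(2) by simp
  then obtain v where v: "v \<in> carrier_vec n" "v \<noteq> 0\<^sub>v n" "A *\<^sub>v v = e \<cdot>\<^sub>v v"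
    using A unfolding eigenvalue_def eigenvector_def by auto
  obtain W c where W: "unitary_mat n W" and colW: "col W 0 = c \<cdot>\<^sub>v v"
    using exists_unitary_mat_first_column[OF v(1,2)] by blast
  have Wc: "W \<in> carrier_mat n n" and Wa: "mat_adjoint W \<in> carrier_mat n n"
    and W1: "mat_adjoint W * W = 1\<^sub>m n" and W2: "W * mat_adjoint W = 1\<^sub>m n"
    using W by (auto simp: unitary_mat_def)
  \<comment> \<open>In the orthonormal basis given by \<open>W\<close>, the first column becomes
    \<open>e\<close> times the first unit vector, and self-adjointness then clears the rest of the
    first row.\<close>
  define A' where "A' = mat_adjoint W * A * W"
  have A': "A' \<in> carrier_mat n n" unfolding A'_def using Wc A by auto
  have adjA': "mat_adjoint A' = A'"
    unfolding A'_def using Wc A adjA by (simp add: mat_adjoint_mult[of _ n n _ n] assoc_mult_mat[of _ n n _ n _ n] mult_carrier_mat[of _ n n _ n])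
  have A_eq: "A = W * A' * mat_adjoint W"
  proof -
    have "W * A' * mat_adjoint W = (W * mat_adjoint W) * A * (W * mat_adjoint W)"
      unfolding A'_def using Wc A by (simp add: assoc_mult_mat[of _ n n _ n _ n] mult_carrier_mat[of _ n n _ n])
    thus ?thesis unfolding W2 using A by simp
  qed
  have "col A' 0 = mat_adjoint W *\<^sub>v (A *\<^sub>v col W 0)"
  proof -
    have "col A' 0 = (mat_adjoint W * A) *\<^sub>v col W 0"
      unfolding A'_def using Wa Wc A n by (intro col_mult2[of _ n n _ n] mult_carrier_mat[of _ n n]) auto
    also have "\<dots> = mat_adjoint W *\<^sub>v (A *\<^sub>v col W 0)"
      by (rule assoc_mult_mat_vec[OF Wa A]) (use Wc in auto)
    finally show ?thesis .
  qed
  also have "A *\<^sub>v col W 0 = e \<cdot>\<^sub>v col W 0"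
    unfolding colW using A v by (simp add: mult_mat_vec[of _ n n] smult_smult_assoc mult.commute)
  also have "mat_adjoint W *\<^sub>v (e \<cdot>\<^sub>v col W 0) = e \<cdot>\<^sub>v col (mat_adjoint W * W) 0"
    using Wc n by (subst col_mult2[of _ n n _ n]) (auto simp: mult_mat_vec[of _ n n])
  finally have col0: "col A' 0 = e \<cdot>\<^sub>v unit_vec n 0" unfolding W1 using n by simp
  have A'0: "A' $$ (i, 0) = (if i = 0 then e else 0)" if "i < n" for i
    using arg_cong[OF col0, of "\<lambda>x. x $ i"] that A' n by auto
  have A'0': "A' $$ (0, j) = 0" if "0 < j" "j < n" for j
    using arg_cong[OF adjA', of "\<lambda>x. x $$ (0, j)"] A'0[of j] that A' n by auto
  define A3 where "A3 = mat k k (\<lambda>(i, j). A' $$ (Suc i, Suc j))"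
  have A3: "A3 \<in> carrier_mat k k" unfolding A3_def by simp
  have A'_eq: "A' = four_block_mat (mat 1 1 (\<lambda>_. e)) (0\<^sub>m 1 k) (0\<^sub>m k 1) A3"
    by (rule eq_matI) (use A' A'0 A'0' n in \<open>auto simp: A3_def\<close>)
  have "mat_adjoint A3 = A3"
  proof (rule eq_matI)
    fix i j assume "i < dim_row A3" "j < dim_col A3"
    thus "mat_adjoint A3 $$ (i, j) = A3 $$ (i, j)"
      using arg_cong[OF adjA', of "\<lambda>x. x $$ (Suc i, Suc j)"] A' n by (simp add: A3_def)
  qed (auto simp: A3_def)
  hence sa3: "selfadjoint_mat k A3" using A3 by (simp add: selfadjoint_mat_def)
  \<comment> \<open>Similarity keeps the characteristic polynomial and the block form factors it.
    Cancelling the factor of \<open>e\<close> leaves the product over \<open>es\<close> for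
    \<open>A3\<close>, as the induction hypothesis requires.\<close>
  have "similar_mat_wit A A' W (mat_adjoint W)"
    by (rule similar_mat_witI[OF W2 W1 A_eq A A' Wc Wa])
  hence "char_poly A = char_poly A'" by (intro char_poly_similar) (auto simp: similar_mat_def)
  also have "\<dots> = char_poly (mat 1 1 (\<lambda>_. e)) * char_poly A3"
    unfolding A'_eq by (rule char_poly_four_block_zeros_col) (use A3 in auto)
  also have "char_poly (mat 1 1 (\<lambda>_. e)) = [:- e, 1:]"
    by (simp add: char_poly_defs det_def sign_def)
  finally have "[:- e, 1:] * char_poly A3 = [:- e, 1:] * (\<Prod>a\<leftarrow>es. [:- a, 1:])"
    unfolding Cons.prems(2) by simp
  hence "char_poly A3 = (\<Prod>a\<leftarrow>es. [:- a, 1:])"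
    by (metis mult_cancel_left pCons_eq_0_iff zero_neq_one)
  from Cons.IH[OF sa3 this] obtain V3 where V3: "unitary_mat k V3"
    and A3_eq: "A3 = V3 * mat_diag k (\<lambda>i. es ! i) * mat_adjoint V3" by blast
  have V3c: "V3 \<in> carrier_mat k k" using V3 by (rule unitary_mat_carrier)
  define X where "X = four_block_mat (1\<^sub>m 1) (0\<^sub>m 1 k) (0\<^sub>m k 1) V3"
  note X = four_block_mat_one_unitary[OF V3, folded X_def]
  have Xc: "X \<in> carrier_mat n n" using unitary_mat_carrier[OF X(1)] n by simp
  define D where "D = mat_diag n (\<lambda>i. (e # es) ! i)"
  have Dc: "D \<in> carrier_mat n n" unfolding D_def by simp
  have D: "D = four_block_mat (mat 1 1 (\<lambda>_. e)) (0\<^sub>m 1 k) (0\<^sub>m k 1) (mat_diag k (\<lambda>i. es ! i))"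
    unfolding D_def n by (rule eq_matI) (auto simp: mat_diag_def)
  have XD: "X * D = four_block_mat (mat 1 1 (\<lambda>_. e)) (0\<^sub>m 1 k) (0\<^sub>m k 1) (V3 * mat_diag k (\<lambda>i. es ! i))"
    unfolding X_def D using V3c
    by (subst mult_four_block_mat[of _ 1 1 _ k _ k _ _ 1 _ k])
      (auto simp: left_mult_zero_mat[OF mat_diag_dim] left_mult_zero_mat[of _ k k] right_mult_zero_mat[of _ k k])
  have "X * D * mat_adjoint X = A'"
    unfolding XD X(2) A'_eq A3_eq using V3c
    by (subst mult_four_block_mat[of _ 1 1 _ k _ k _ _ 1 _ k])
      (auto simp: left_mult_zero_mat[OF mat_diag_dim] left_mult_zero_mat[of _ k k] right_mult_zero_mat[of _ k k])
  hence "A = W * (X * D * mat_adjoint X) * mat_adjoint W" using A_eq by simp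
  also have "\<dots> = (W * X) * D * mat_adjoint (W * X)"
    using Wc Xc Dc by (simp add: mat_adjoint_mult[of _ n n _ n] assoc_mult_mat[of _ n n _ n _ n] mult_carrier_mat[of _ n n _ n])
  finally show ?case
    using unitary_mat_mult[OF W, of X] X(1) n unfolding D_def by blast
qed

section \<open>Norms of unitarily diagonalised matrices\<close>

lemma vec_norm2_unitary:
  assumes U: "unitary_mat n U" and x: "x \<in> carrier_vec n"
  shows "vec_norm2 (U *\<^sub>v x) = vec_norm2 x"
proof -
  have c: "U \<in> carrier_mat n n" using U by (rule unitary_mat_carrier)
  \<comment> \<open>Orthonormality of the columns of \<open>U\<close>, which collapses the expanded
    square of the norm to its diagonal terms.\<close>
  have one: "(\<Sum>i<n. U $$ (i, j) * cnj (U $$ (i, k))) = (if k = j then 1 else 0)" if "j < n" "k < n" for j k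
  proof -
    have "(mat_adjoint U * U) $$ (k, j) = (\<Sum>i<n. cnj (U $$ (i, k)) * U $$ (i, j))"
      using that c by (simp add: scalar_prod_def lessThan_atLeast0)
    thus ?thesis using U that by (simp add: unitary_mat_def mult.commute)
  qed
  have "complex_of_real ((vec_norm2 (U *\<^sub>v x))\<^sup>2) =
      (\<Sum>i<n. (\<Sum>j<n. U $$ (i, j) * x $ j) * cnj (\<Sum>k<n. U $$ (i, k) * x $ k))"
    using c x by (simp add: cscalar_prod_self[symmetric] scalar_prod_def lessThan_atLeast0 del: of_real_power)
  also have "\<dots> = (\<Sum>i<n. \<Sum>j<n. \<Sum>k<n. x $ j * cnj (x $ k) * (U $$ (i, j) * cnj (U $$ (i, k))))"
    by (simp add: sum_product cnj_sum mult_ac)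
  also have "\<dots> = (\<Sum>j<n. \<Sum>k<n. \<Sum>i<n. x $ j * cnj (x $ k) * (U $$ (i, j) * cnj (U $$ (i, k))))"
    by (subst sum.swap, rule sum.cong[OF refl], rule sum.swap)
  also have "\<dots> = (\<Sum>j<n. \<Sum>k<n. x $ j * cnj (x $ k) * (if k = j then 1 else 0))"
    by (intro sum.cong refl) (simp add: one flip: sum_distrib_left)
  also have "\<dots> = (\<Sum>j<n. \<Sum>k<n. if k = j then x $ j * cnj (x $ j) else 0)"
    by (intro sum.cong refl) auto
  also have "\<dots> = complex_of_real ((vec_norm2 x)\<^sup>2)"
    using x by (simp add: cscalar_prod_self[symmetric] scalar_prod_def lessThan_atLeast0 del: of_real_power)
  finally have "(vec_norm2 (U *\<^sub>v x))\<^sup>2 = (vec_norm2 x)\<^sup>2" by (simp only: of_real_eq_iff)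
  thus ?thesis by (simp add: vec_norm2_def L2_set_def sum_nonneg)
qed

lemma vec_norm2_mat_diag_le:
  assumes x: "x \<in> carrier_vec n" and d: "\<And>i. i < n \<Longrightarrow> cmod (d i) \<le> c" and c: "c \<ge> 0"
  shows "vec_norm2 (mat_diag n d *\<^sub>v x) \<le> c * vec_norm2 x"
proof -
  have idx: "(mat_diag n d *\<^sub>v x) $ i = d i * x $ i" if "i < n" for i
  proof -
    have "(mat_diag n d *\<^sub>v x) $ i = (\<Sum>j = 0..<n. (if i = j then d j else 0) * x $ j)"
      using that x by (simp add: mat_diag_def scalar_prod_def)
    also have "\<dots> = (\<Sum>j = 0..<n. if j = i then d i * x $ i else 0)" by (rule sum.cong) auto
    finally show ?thesis using that by simp
  qed
  have "vec_norm2 (mat_diag n d *\<^sub>v x) \<le> L2_set (\<lambda>i. c * cmod (x $ i)) {..<n}"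
    unfolding vec_norm2_def
    by (rule order.trans[OF _ L2_set_mono[where f = "\<lambda>i. cmod (d i * x $ i)"]])
      (use idx d c x in \<open>auto simp: L2_set_def mat_diag_def norm_mult mult_right_mono\<close>)
  also have "\<dots> = c * vec_norm2 x"
    using c x by (simp add: vec_norm2_def L2_set_right_distrib)
  finally show ?thesis .
qed

lemma vec_norm2_unitary_diag_le:
  assumes V: "unitary_mat n V" and x: "x \<in> carrier_vec n"
    and d: "\<And>i. i < n \<Longrightarrow> cmod (d i) \<le> c" and c: "c \<ge> 0"
  shows "vec_norm2 ((V * mat_diag n d * mat_adjoint V) *\<^sub>v x) \<le> c * vec_norm2 x"
proof -
  have Vc: "V \<in> carrier_mat n n" using V by (rule unitary_mat_carrier)
  have y: "mat_adjoint V *\<^sub>v x \<in> carrier_vec n"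
    by (rule mult_mat_vec_carrier[OF mat_adjoint_carrier[OF Vc] x])
  have "(V * mat_diag n d * mat_adjoint V) *\<^sub>v x = V *\<^sub>v (mat_diag n d *\<^sub>v (mat_adjoint V *\<^sub>v x))"
    using Vc x y by (simp add: assoc_mult_mat_vec[of _ n n _ n] mult_carrier_mat[of _ n n _ n])
  moreover have "mat_diag n d *\<^sub>v (mat_adjoint V *\<^sub>v x) \<in> carrier_vec n"
    using y by (intro mult_mat_vec_carrier[OF mat_diag_dim])
  ultimately have "vec_norm2 ((V * mat_diag n d * mat_adjoint V) *\<^sub>v x) =
      vec_norm2 (mat_diag n d *\<^sub>v (mat_adjoint V *\<^sub>v x))"
    by (simp add: vec_norm2_unitary[OF V])
  also have "\<dots> \<le> c * vec_norm2 (mat_adjoint V *\<^sub>v x)" by (rule vec_norm2_mat_diag_le[OF y _ c]) (rule d)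
  finally show ?thesis by (simp add: vec_norm2_unitary[OF unitary_mat_adjoint[OF V] x])
qed

text \<open>The second claim is needed for lower bounds on \<open>op_norm\<close>: a real supremum
  dominates its members only when the set is bounded.\<close>

lemma op_norm_unitary_diag_le:
  assumes V: "unitary_mat n V" and d: "\<And>i. i < n \<Longrightarrow> cmod (d i) \<le> c" and c: "c \<ge> 0"
  shows "op_norm (V * mat_diag n d * mat_adjoint V) \<le> c"
    and "bdd_above ((\<lambda>x. vec_norm2 ((V * mat_diag n d * mat_adjoint V) *\<^sub>v x)) `
      {x \<in> carrier_vec (dim_col (V * mat_diag n d * mat_adjoint V)). vec_norm2 x \<le> 1})"
proof -
  have dim: "dim_col (V * mat_diag n d * mat_adjoint V) = n"
    using unitary_mat_carrier[OF V] by simp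
  have *: "vec_norm2 ((V * mat_diag n d * mat_adjoint V) *\<^sub>v x) \<le> c"
    if "x \<in> carrier_vec n" "vec_norm2 x \<le> 1" for x
  proof -
    have "vec_norm2 ((V * mat_diag n d * mat_adjoint V) *\<^sub>v x) \<le> c * vec_norm2 x"
      by (rule vec_norm2_unitary_diag_le[OF V that(1) _ c]) (rule d)
    thus ?thesis using mult_left_mono[OF that(2) c] by simp
  qed
  \<comment> \<open>The zero vector makes the unit ball nonempty, also for \<open>n = 0\<close>, as
    an upper bound on the supremum demands.\<close>
  have "0\<^sub>v n \<in> {x \<in> carrier_vec n. vec_norm2 x \<le> 1}"
    by (simp add: vec_norm2_def L2_set_def)
  hence ne: "{x \<in> carrier_vec n. vec_norm2 x \<le> 1} \<noteq> {}" by blast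
  show "op_norm (V * mat_diag n d * mat_adjoint V) \<le> c"
    unfolding op_norm_def dim by (rule cSUP_least[OF ne]) (use * in auto)
  show "bdd_above ((\<lambda>x. vec_norm2 ((V * mat_diag n d * mat_adjoint V) *\<^sub>v x)) `
      {x \<in> carrier_vec (dim_col (V * mat_diag n d * mat_adjoint V)). vec_norm2 x \<le> 1})"
    unfolding dim by (rule bdd_aboveI2[of _ _ c]) (use * in auto)
qed

text \<open>Test the norm on the \<open>i\<close>-th column of \<open>V\<close>, a unit eigenvector
  for \<open>d i\<close>.\<close>

lemma eigenvalue_le_op_norm:
  assumes V: "unitary_mat n V" and A: "A = V * mat_diag n d * mat_adjoint V" and i: "i < n"
  shows "cmod (d i) \<le> op_norm A"
proof -
  have Vc: "V \<in> carrier_mat n n" using V by (rule unitary_mat_carrier)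
  have Ac: "A \<in> carrier_mat n n" unfolding A using Vc by (intro mult_carrier_mat[of _ n n]) auto
  define x where "x = V *\<^sub>v unit_vec n i"
  have x: "x \<in> carrier_vec n" unfolding x_def using Vc by auto
  have norm_unit: "vec_norm2 (c \<cdot>\<^sub>v unit_vec n i) = cmod c" for c
  proof -
    have "(\<Sum>j<n. (cmod (c * (if j = i then 1 else 0)))\<^sup>2) = (\<Sum>j<n. if j = i then (cmod c)\<^sup>2 else 0)"
      by (rule sum.cong) auto
    thus ?thesis using i by (simp add: vec_norm2_def L2_set_def unit_vec_def)
  qed
  have "vec_norm2 x = 1"
    unfolding x_def using vec_norm2_unitary[OF V, of "unit_vec n i"] norm_unit[of 1] by simp
  have "mat_adjoint V *\<^sub>v x = (mat_adjoint V * V) *\<^sub>v unit_vec n i"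
    unfolding x_def using Vc by (intro assoc_mult_mat_vec[symmetric, of _ n n _ n]) auto
  hence "mat_adjoint V *\<^sub>v x = unit_vec n i" using V by (simp add: unitary_mat_def)
  moreover have "mat_diag n d *\<^sub>v unit_vec n i = d i \<cdot>\<^sub>v unit_vec n i"
    using i by (intro eq_vecI) (auto simp: mat_diag_def)
  ultimately have "A *\<^sub>v x = V *\<^sub>v (d i \<cdot>\<^sub>v unit_vec n i)"
    unfolding A using Vc x by (simp add: assoc_mult_mat_vec[of _ n n _ n] mult_carrier_mat[of _ n n _ n])
  hence "vec_norm2 (A *\<^sub>v x) = cmod (d i)"
    using vec_norm2_unitary[OF V, of "d i \<cdot>\<^sub>v unit_vec n i"] by (simp add: norm_unit)
  moreover have "vec_norm2 (A *\<^sub>v x) \<le> op_norm A"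
    unfolding op_norm_def
  proof (rule cSUP_upper)
    show "x \<in> {x \<in> carrier_vec (dim_col A). vec_norm2 x \<le> 1}" using x Ac \<open>vec_norm2 x = 1\<close> by auto
    \<comment> \<open>Any common bound of the diagonal gives boundedness; the sum of all moduli is
      one that also covers every case uniformly.\<close>
    have "cmod (d i) \<le> (\<Sum>j<n. cmod (d j))" if "i < n" for i
      using that by (intro member_le_sum) auto
    thus "bdd_above ((\<lambda>x. vec_norm2 (A *\<^sub>v x)) ` {x \<in> carrier_vec (dim_col A). vec_norm2 x \<le> 1})"
      unfolding A by (intro op_norm_unitary_diag_le(2)[OF V, where c = "\<Sum>j<n. cmod (d j)"]) (auto intro: sum_nonneg)
  qed
  ultimately show ?thesis by simp
qed

section \<open>Eigenvalue lists of positive matrices and diagonals in a prescribed order\<close>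

lemma positive_mat_eigenvalues_desc:
  assumes A: "positive_mat m A"
  shows "length (eigenvalues_desc A) = m"
    and "mset (map complex_of_real (eigenvalues_desc A)) = proots (char_poly A)"
    and "char_poly A = (\<Prod>a\<in>#proots (char_poly A). [:- a, 1:])"
    and "x \<in> set (eigenvalues_desc A) \<Longrightarrow> x \<ge> 0"
proof -
  have Ac: "A \<in> carrier_mat m m" using A by (simp add: positive_mat_def selfadjoint_mat_def)
  obtain as where as: "char_poly A = (\<Prod>a\<leftarrow>as. [:- a, 1:])" "length as = m"
    using char_poly_factorized[OF Ac] by blast
  have pr: "proots (char_poly A) = mset as"
    unfolding as(1)
  proof (induction as)
    case (Cons a as)
    show ?case unfolding list.map prod_list.Cons
      by (subst proots_mult) (use Cons in \<open>auto simp: prod_list_zero_iff\<close>)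
  qed simp
  show "char_poly A = (\<Prod>a\<in>#proots (char_poly A). [:- a, 1:])"
    unfolding pr using as(1) by (simp only: mset_map[symmetric] prod_mset_prod_list)
  \<comment> \<open>Roots of the characteristic polynomial lie in the spectrum, hence are
    nonnegative reals. Taking \<open>Re\<close> therefore loses nothing, and the root multiset is
    recovered from the sorted list.\<close>
  have sp: "a \<in> complex_of_real ` {0..}" if "a \<in> set as" for a
  proof -
    have "poly (char_poly A) a = 0" unfolding as(1) poly_prod_list prod_list_zero_iff using that by force
    thus ?thesis using A unfolding positive_mat_def spectrum_root_char_poly[OF Ac] by blast
  qed
  have ms: "mset (eigenvalues_desc A) = image_mset Re (mset as)"
    unfolding eigenvalues_desc_def pr by simp
  show "length (eigenvalues_desc A) = m" using arg_cong[OF ms, of size] as(2) by simp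
  have "image_mset (\<lambda>a. complex_of_real (Re a)) (mset as) = image_mset (\<lambda>a. a) (mset as)"
  proof (rule image_mset_cong)
    fix a assume "a \<in># mset as"
    hence "a \<in> complex_of_real ` {0..}" by (intro sp) simp
    thus "complex_of_real (Re a) = a" by auto
  qed
  thus "mset (map complex_of_real (eigenvalues_desc A)) = proots (char_poly A)"
    by (simp add: ms pr image_mset.compositionality o_def)
  show "x \<ge> 0" if "x \<in> set (eigenvalues_desc A)"
  proof -
    have "x \<in> set_mset (mset (eigenvalues_desc A))" using that by simp
    then obtain a where "a \<in> set as" "x = Re a" unfolding ms by auto
    thus ?thesis using sp[of a] by auto
  qed
qed

text \<open>Permuting the eigenvalue list keeps its multiset, hence the factorisation of the
  characteristic polynomial, so the spectral theorem applies to the reordered list.\<close>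

lemma positive_mat_unitary_diagonalization:
  assumes A: "positive_mat m A" and p: "p permutes {..<m}"
  shows "\<exists>V. unitary_mat m V \<and>
    A = V * mat_diag m (\<lambda>i. complex_of_real (eigenvalues_desc A ! p i)) * mat_adjoint V"
proof -
  define es where "es = map complex_of_real (eigenvalues_desc A)"
  have len: "length es = m" using positive_mat_eigenvalues_desc(1)[OF A] by (simp add: es_def)
  have ms: "mset (permute_list p es) = proots (char_poly A)"
    using mset_permute_list[of p es] p positive_mat_eigenvalues_desc(2)[OF A] len by (simp add: es_def)
  have "char_poly A = (\<Prod>a\<leftarrow>permute_list p es. [:- a, 1:])"
    by (subst positive_mat_eigenvalues_desc(3)[OF A], subst ms[symmetric])
      (simp only: mset_map[symmetric] prod_mset_prod_list)
  moreover have "selfadjoint_mat m A" using A by (simp add: positive_mat_def)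
  ultimately obtain V where V: "unitary_mat m V"
    "A = V * mat_diag m (\<lambda>i. permute_list p es ! i) * mat_adjoint V"
    using selfadjoint_unitary_diagonalization by blast
  have "mat_diag m (\<lambda>i. permute_list p es ! i) = mat_diag m (\<lambda>i. complex_of_real (eigenvalues_desc A ! p i))"
    using len permutes_in_image[OF p]
    by (intro eq_matI) (auto simp: mat_diag_def permute_list_nth p es_def)
  thus ?thesis using V by metis
qed

text \<open>All conjugates are diagonal in the same basis \<open>V\<close>, so the combination can
  be formed on the diagonals, by induction on the number of terms.\<close>

lemma unitary_combination_diag:
  assumes V: "V \<in> carrier_mat m m"
    and eq: "\<And>k. k \<in> {1..N} \<Longrightarrow>
      mat_adjoint (U k) * B * U k = V * mat_diag m (\<lambda>i. complex_of_real (d k i)) * mat_adjoint V"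
  shows "unitary_combination m N t U B =
    V * mat_diag m (\<lambda>i. complex_of_real (\<Sum>k=1..N. t k * d k i)) * mat_adjoint V"
  using eq unfolding unitary_combination_def
proof (induction N)
  case 0
  interpret abelian_group "module_mat TYPE(complex) m m" by (rule abelian_group_mat)
  have "mat_diag m (\<lambda>i. 0) = (0\<^sub>m m m :: complex mat)" by (rule eq_matI) (auto simp: mat_diag_def)
  thus ?case using V by (simp add: module_mat_simps left_mult_zero_mat[of _ m m] right_mult_zero_mat[of _ m m])
next
  case (Suc N)
  interpret abelian_group "module_mat TYPE(complex) m m" by (rule abelian_group_mat)
  let ?M = "\<lambda>d. V * mat_diag m (\<lambda>i. complex_of_real (d i)) * mat_adjoint V"
  let ?f = "\<lambda>k. complex_of_real (t k) \<cdot>\<^sub>m (mat_adjoint (U k) * B * U k)"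
  have Mc: "?M d \<in> carrier_mat m m" for d using V by (intro mult_carrier_mat[of _ m m]) auto
  have "?f k \<in> carrier_mat m m" if "k \<in> {1..Suc N}" for k
    using that Mc[of "d k"] by (simp add: Suc.prems)
  hence "finsum (module_mat TYPE(complex) m m) ?f (insert (Suc N) {1..N}) =
      ?f (Suc N) + finsum (module_mat TYPE(complex) m m) ?f {1..N}"
    by (subst finsum_insert) (auto simp: module_mat_simps)
  also have "insert (Suc N) {1..N} = {1..Suc N}" by auto
  also have "finsum (module_mat TYPE(complex) m m) ?f {1..N} = ?M (\<lambda>i. \<Sum>k=1..N. t k * d k i)"
    by (rule Suc.IH) (use Suc.prems in auto)
  also have "?f (Suc N) = ?M (\<lambda>i. t (Suc N) * d (Suc N) i)"
  proof -
    have "mat_diag m (\<lambda>i. complex_of_real (t (Suc N) * d (Suc N) i)) =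
        complex_of_real (t (Suc N)) \<cdot>\<^sub>m mat_diag m (\<lambda>i. complex_of_real (d (Suc N) i))"
      by (rule eq_matI) (auto simp: mat_diag_def)
    thus ?thesis using V
      by (simp add: Suc.prems mult_smult_distrib[of _ m m _ m] mult_smult_assoc_mat[of _ m m _ m]
          mult_carrier_mat[of _ m m _ m])
  qed
  also have "?M (\<lambda>i. t (Suc N) * d (Suc N) i) + ?M (\<lambda>i. \<Sum>k=1..N. t k * d k i) =
      ?M (\<lambda>i. \<Sum>k=1..Suc N. t k * d k i)"
  proof -
    have "mat_diag m (\<lambda>i. complex_of_real (\<Sum>k=1..Suc N. t k * d k i)) =
        mat_diag m (\<lambda>i. complex_of_real (t (Suc N) * d (Suc N) i)) +
        mat_diag m (\<lambda>i. complex_of_real (\<Sum>k=1..N. t k * d k i))"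
      by (rule eq_matI) (auto simp: mat_diag_def)
    thus ?thesis using V
      by (simp add: mult_add_distrib_mat[of _ m m _ m] add_mult_distrib_mat[of _ m m _ _ m]
          mult_carrier_mat[of _ m m _ m])
  qed
  finally show ?case .
qed

section \<open>Approximation by unitary conjugates\<close>

lemma eigenvalues_desc_mono:
  assumes "i \<le> j" "j < length (eigenvalues_desc A)"
  shows "eigenvalues_desc A ! j \<le> eigenvalues_desc A ! i"
  using assms by (auto simp: eigenvalues_desc_def rev_nth intro!: sorted_nth_mono)

lemma positive_contraction_eigenvalues_desc:
  assumes B: "positive_contraction m B" and i: "i < m"
  shows "eigenvalues_desc B ! i \<in> {0..1}"
proof -
  have pos: "positive_mat m B" using B by (simp add: positive_contraction_def)
  have "eigenvalues_desc B ! i \<in> set (eigenvalues_desc B)"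
    using i positive_mat_eigenvalues_desc(1)[OF pos] by (intro nth_mem) simp
  hence "eigenvalues_desc B ! i \<ge> 0" by (rule positive_mat_eigenvalues_desc(4)[OF pos])
  moreover obtain V where V: "unitary_mat m V"
    "B = V * mat_diag m (\<lambda>i. complex_of_real (eigenvalues_desc B ! i)) * mat_adjoint V"
    using positive_mat_unitary_diagonalization[OF pos permutes_id] by auto
  have "eigenvalues_desc B ! i \<le> op_norm B"
    using eigenvalue_le_op_norm[OF V i] by simp
  ultimately show ?thesis using B by (simp add: positive_contraction_def)
qed

lemma unitary_diag_diff:
  fixes V :: "complex mat"
  assumes V: "V \<in> carrier_mat m m"
  shows "V * mat_diag m d * mat_adjoint V - V * mat_diag m d' * mat_adjoint V =
    V * mat_diag m (\<lambda>i. d i - d' i) * mat_adjoint V"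
proof -
  have "mat_diag m (\<lambda>i. d i - d' i) = mat_diag m d - mat_diag m d'"
    by (rule eq_matI) (auto simp: mat_diag_def)
  thus ?thesis using V
    by (simp add: mult_minus_distrib_mat[of _ m m _ m] minus_mult_distrib_mat[of _ m m _ _ m]
        mult_carrier_mat[of _ m m _ m])
qed

text \<open>\<open>W * mat_adjoint V\<close> carries the basis of columns of \<open>V\<close> to
  that of \<open>W\<close>. Conjugating by it moves the diagonal \<open>D\<close> of
  \<open>B\<close> into the basis \<open>V\<close>.\<close>

lemma unitary_conjugation_common_basis:
  assumes W: "unitary_mat m W" and V: "unitary_mat m V" and D: "D \<in> carrier_mat m m"
    and B: "B = W * D * mat_adjoint W"
  shows "mat_adjoint (W * mat_adjoint V) * B * (W * mat_adjoint V) = V * D * mat_adjoint V"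
proof -
  have c: "W \<in> carrier_mat m m" "V \<in> carrier_mat m m" using W V by (auto intro: unitary_mat_carrier)
  have "mat_adjoint (W * mat_adjoint V) * B * (W * mat_adjoint V) =
      V * (mat_adjoint W * W) * D * (mat_adjoint W * W) * mat_adjoint V"
    unfolding B using c D
    by (simp add: mat_adjoint_mult[of _ m m _ m] assoc_mult_mat[of _ m m _ m _ m] mult_carrier_mat[of _ m m _ m])
  thus ?thesis using W c D by (simp add: unitary_mat_def mult_carrier_mat[of _ m m _ m])
qed

text \<open>Every conjugate of \<open>B\<close> is arranged to be diagonal in an eigenbasis
  \<open>V\<close> of \<open>A\<close>. The norm of the difference is then bounded by the largest
  error of the permutation average.\<close>

lemma suffices_unitaries_of_square_le:
  assumes K: "K > 0" and NK: "N \<ge> K\<^sup>2" and bound: "2 / real K < 4 / (real n - 1) + 5 / real n"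
  shows "suffices_unitaries n N"
  unfolding suffices_unitaries_def
proof (intro allI impI)
  fix m A B
  assume A: "positive_contraction m A" and B: "positive_contraction m B" and AB: "tr_majorized m A B"
  have N: "N > 0" using K NK by (cases N) auto
  have pA: "positive_mat m A" and pB: "positive_mat m B" using A B by (auto simp: positive_contraction_def)
  define a where "a i = eigenvalues_desc A ! i" for i
  define b where "b i = eigenvalues_desc B ! i" for i
  \<comment> \<open>Majorization is stated for \<open>l\<close> from 1 on with positions
    \<open>k - 1\<close>. The sums are shifted to start at 0, and the empty prefix is treated
    separately.\<close>
  have pre: "(\<Sum>i<l. a i) \<le> (\<Sum>i<l. b i)" if "l \<le> m" for l
    using AB that by (cases "l = 0") (auto simp: tr_majorized_def a_def b_def sum.atLeast1_atMost_eq)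
  have sums: "(\<Sum>i<m. b i) = (\<Sum>i<m. a i)"
    using AB by (simp add: tr_majorized_def a_def b_def sum.atLeast1_atMost_eq)
  have dec: "a j \<le> a i" if "i \<le> j" "j < m" for i j
    unfolding a_def using that positive_mat_eigenvalues_desc(1)[OF pA] by (intro eigenvalues_desc_mono) auto
  have maj: "(\<Sum>i\<in>T. a i - t) \<le> (\<Sum>i<m. max (b i - t) 0)" if "T \<subseteq> {..<m}" for T t
    by (rule sum_le_sum_max_of_prefix_sums[OF _ _ that]) (use dec pre in auto)
  have range: "b i \<in> {0..1}" if "i < m" for i
    unfolding b_def by (rule positive_contraction_eigenvalues_desc[OF B that])
  obtain \<sigma> where perm: "\<And>s. s < N \<Longrightarrow> \<sigma> s permutes {..<m}"
    and err: "\<And>i. i < m \<Longrightarrow> \<bar>(\<Sum>s<N. b (\<sigma> s i)) / N - a i\<bar> < 2 / K"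
    using exists_permutation_average[OF K NK range sums maj] by blast
  obtain V where V: "unitary_mat m V" and A_eq: "A = V * mat_diag m (\<lambda>i. complex_of_real (a i)) * mat_adjoint V"
    using positive_mat_unitary_diagonalization[OF pA permutes_id] unfolding a_def by auto
  \<comment> \<open>The order \<open>\<sigma> s\<close> of the eigenvalues is absorbed into the
    choice of an eigenbasis \<open>W s\<close> of \<open>B\<close>.\<close>
  have "\<forall>s. \<exists>W. s < N \<longrightarrow> unitary_mat m W \<and>
      B = W * mat_diag m (\<lambda>i. complex_of_real (b (\<sigma> s i))) * mat_adjoint W"
    using positive_mat_unitary_diagonalization[OF pB perm] unfolding b_def by blast
  then obtain W where W: "\<And>s. s < N \<Longrightarrow> unitary_mat m (W s)"
    and B_eq: "\<And>s. s < N \<Longrightarrow> B = W s * mat_diag m (\<lambda>i. complex_of_real (b (\<sigma> s i))) * mat_adjoint (W s)"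
    by metis
  \<comment> \<open>Unitaries are numbered from 1 and permutations from 0, hence
    \<open>k - 1\<close>. All weights are equal, matching the plain average over
    \<open>s\<close>.\<close>
  define U where "U k = W (k - 1) * mat_adjoint V" for k
  define t where "t k = 1 / real N" for k :: nat
  have U: "unitary_mat m (U k)" if "k \<in> {1..N}" for k
    unfolding U_def using that by (intro unitary_mat_mult W unitary_mat_adjoint V) auto
  have "unitary_combination m N t U B =
      V * mat_diag m (\<lambda>i. complex_of_real (\<Sum>k=1..N. t k * b (\<sigma> (k - 1) i))) * mat_adjoint V"
  proof (rule unitary_combination_diag)
    show "V \<in> carrier_mat m m" using V by (rule unitary_mat_carrier)
    fix k assume "k \<in> {1..N}"
    hence k: "k - 1 < N" by auto
    show "mat_adjoint (U k) * B * U k = V * mat_diag m (\<lambda>i. complex_of_real (b (\<sigma> (k - 1) i))) * mat_adjoint V"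
      unfolding U_def by (rule unitary_conjugation_common_basis[OF W[OF k] V mat_diag_dim B_eq[OF k]])
  qed
  also have "(\<lambda>i. \<Sum>k=1..N. t k * b (\<sigma> (k - 1) i)) = (\<lambda>i. (\<Sum>s<N. b (\<sigma> s i)) / N)"
    by (simp add: t_def sum.atLeast1_atMost_eq sum_divide_distrib)
  finally have "A - unitary_combination m N t U B = V * mat_diag m (\<lambda>i. complex_of_real (a i) -
      complex_of_real ((\<Sum>s<N. b (\<sigma> s i)) / N)) * mat_adjoint V"
    using unitary_diag_diff[OF unitary_mat_carrier[OF V]] A_eq by simp
  also have "op_norm \<dots> \<le> 2 / K"
  proof (rule op_norm_unitary_diag_le(1)[OF V])
    fix i assume "i < m"
    thus "cmod (complex_of_real (a i) - complex_of_real ((\<Sum>s<N. b (\<sigma> s i)) / N)) \<le> 2 / K"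
      using err[of i] unfolding of_real_diff[symmetric] norm_of_real by linarith
  qed simp
  finally have "op_norm (A - unitary_combination m N t U B) < 4 / (real n - 1) + 5 / real n"
    using bound by linarith
  moreover have "t k \<in> {0..1}" for k unfolding t_def using N by auto
  moreover have "(\<Sum>k=1..N. t k) = 1" unfolding t_def using N by simp
  ultimately show "\<exists>U t. (\<forall>k\<in>{1..N}. unitary_mat m (U k)) \<and> (\<forall>k\<in>{1..N}. t k \<in> {0..1}) \<and>
      (\<Sum>k=1..N. t k) = 1 \<and> op_norm (A - unitary_combination m N t U B) < 4 / (real n - 1) + 5 / real n"
    using U by blast
qed

theorem theorem6p1:
  fixes n :: nat
  assumes "n \<ge> 2"
  shows "(\<exists>N. suffices_unitaries n N) \<and> suffices_unitaries n (2 ^ ((n ^ 3 - n) div 6))"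
proof -
  \<comment> \<open>The choice is \<open>K = n - 1\<close>, with error at most
    \<open>2 / (n - 1)\<close>; the positive term \<open>5 / n\<close> makes the final inequality
    strict.\<close>
  have "2 / real (n - 1) \<le> 4 / (real n - 1)"
    using assms by (simp add: of_nat_diff divide_right_mono)
  hence "2 / real (n - 1) + 0 < 4 / (real n - 1) + 5 / real n"
    using assms by (intro add_le_less_mono) auto
  hence "suffices_unitaries n (2 ^ ((n ^ 3 - n) div 6))"
    using assms square_le_two_power[OF assms] by (intro suffices_unitaries_of_square_le[of "n - 1"]) (auto simp del: of_nat_diff)
  thus ?thesis by blast
qed

end
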